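(* Let $\mathbb{G}=(\mathbb{V},\mathbb{E})$ be an acyclic connected graph, and let $\mathrm{T}_1,\mathrm{T}_2\in\mathbb{F}^{M\times N}$, with $M=\sum_{i\in\mathbb{V}}m_i$ and $N=\sum_{i\in\mathbb{V}}n_i$, be TQS matrices on $\mathbb{G}$ (both with output dimensions $\{m_i\}_{i\in\mathbb{V}}$ and input dimensions $\{n_i\}_{i\in\mathbb{V}}$) of rank-profiles $\{\rho_{1,e}\}_{e\in\mathbb{E}}$ and $\{\rho_{2,e}\}_{e\in\mathbb{E}}$ respectively. Then $\mathrm{T}_3=\mathrm{T}_1+\mathrm{T}_2$ is a TQS matrix on $\mathbb{G}$ (with the same input and output dimensions) of rank-profile $\{\rho_{1,e}+\rho_{2,e}\}_{e\in\mathbb{E}}$.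
   Context: $\mathbb{F}$ is a field. $\mathbb{G}=(\mathbb{V},\mathbb{E})$ is a finite connected acyclic undirected graph (a tree) with $\mathbb{V}=\{1,\dots,K\}$. The edge set $\mathbb{E}$ is regarded as a set of ordered pairs with $(i,j)\in\mathbb{E}$ iff $(j,i)\in\mathbb{E}$ (both orientations of each edge are included; no loops). $\mathcal{N}(i)$ is the set of neighbors of $i$. Any two distinct nodes are joined by a unique (non-self-intersecting) path. Graph-partitioned matrix: each node $i$ has an input dimension $n_i\ge 0$ and an output dimension $m_i\ge 0$ (integers, zero allowed); $M=\sum_i m_i$, $N=\sum_i n_i$. A matrix $\mathrm{T}\in\mathbb{F}^{M\times N}$ is block-partitioned with blocks $\mathrm{T}\{i,j\}\in\mathbb{F}^{m_i\times n_j}$, $i,j\in\mathbb{V}$. TQS matrix: given nonnegative integer weights $\{\rho_e\}_{e\in\mathbb{E}}$ (the rank-profile; $\rho_{(i,j)}$ and $\rho_{(j,i)}$ may differ), $\mathrm{T}$ is a tree quasi-separable (TQS) matrix on $\mathbb{G}$ with input dimensions $\{n_i\}$, output dimensions $\{m_i\}$ and rank-profile $\{\rho_e\}$ if there exist matrices $\mathrm{D}^k\in\mathbb{F}^{m_k\times n_k}$ ($k\in\mathbb{V}$), $\mathrm{Inp}^k_j\in\mathbb{F}^{\rho_{(k,j)}\times n_k}$ ($(k,j)\in\mathbb{E}$), $\mathrm{Trans}^k_{i,j}\in\mathbb{F}^{\rho_{(k,i)}\times\rho_{(j,k)}}$ ($i\neq j$ in $\mathcal{N}(k)$), $\mathrm{Out}^k_i\in\mathbb{F}^{m_k\times\rho_{(i,k)}}$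 ($(i,k)\in\mathbb{E}$) such that $\mathrm{T}\{i,i\}=\mathrm{D}^i$ and, for $i\ne j$ with unique path $j=p_0-p_1-\cdots-p_\nu=i$, $$\mathrm{T}\{i,j\}=\mathrm{Out}^i_{p_{\nu-1}}\,\mathrm{Trans}^{p_{\nu-1}}_{i,p_{\nu-2}}\cdots\mathrm{Trans}^{p_2}_{p_3,p_1}\,\mathrm{Trans}^{p_1}_{p_2,j}\,\mathrm{Inp}^j_{p_1}$$ (for $\nu=1$ this reads $\mathrm{Out}^i_j\,\mathrm{Inp}^j_i$). *)

theory Defs
  imports
    "Jordan_Normal_Form.Matrix"
    "Graph_Theory.Digraph_Component"
    "Graph_Theory.Vertex_Walk"
begin

text \<open>
  An undirected graph is modelled as a symmetric loop-free digraph, so that an edge contributes both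
  of its orientations to \<^term>\<open>parcs G\<close>. The library predicates \<^const>\<open>forest\<close> and
  \<^const>\<open>tree\<close> are of no use here: for them the closed walk \<open>a, b, a\<close> along a single edge
  is already a cycle. In a simple graph the undirected cycles are exactly the cycles of length at
  least 3.
\<close>

locale tree_graph = pair_graph G for G :: "nat pair_pre_digraph" +
  fixes K :: nat
  assumes verts_eq: "pverts G = {1..K}"
    and conn: "Digraph_Component.connected (with_proj G)"
    and acyclic: "\<not> (\<exists>c. pre_digraph.cycle (with_proj G) c \<and> 3 \<le> length c)"

definition neighbors :: "nat pair_pre_digraph \<Rightarrow> nat \<Rightarrow> nat set" where
  "neighbors G k = {i. (k, i) \<in> parcs G}"

definition offset :: "(nat \<Rightarrow> nat) \<Rightarrow> nat \<Rightarrow> nat" where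
  "offset d i = (\<Sum>l\<in>{1..<i}. d l)"

definition block :: "(nat \<Rightarrow> nat) \<Rightarrow> (nat \<Rightarrow> nat) \<Rightarrow> 'a mat \<Rightarrow> nat \<Rightarrow> nat \<Rightarrow> 'a mat" where
  "block m n T i j = mat (m i) (n j) (\<lambda>(r, c). T $$ (offset m i + r, offset n j + c))"

text \<open>
  \<open>Inp k j\<close>, \<open>Trans k i j\<close> and \<open>Out k i\<close> stand for $\mathrm{Inp}^k_j$,
  $\mathrm{Trans}^k_{i,j}$ and $\mathrm{Out}^k_i$. For a vertex list $[p_0, \dots, p_\nu]$ with
  $\nu \ge 1$, the function \<open>out_trans\<close> is the product
  $\mathrm{Out}^{p_\nu}_{p_{\nu-1}} \mathrm{Trans}^{p_{\nu-1}}_{p_\nu,p_{\nu-2}} \cdots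
   \mathrm{Trans}^{p_1}_{p_2,p_0}$, and \<open>path_prod\<close> is this product times
  $\mathrm{Inp}^{p_0}_{p_1}$. Shorter lists are never used.
\<close>

fun out_trans ::
  "(nat \<Rightarrow> nat \<Rightarrow> nat \<Rightarrow> 'a::field mat) \<Rightarrow> (nat \<Rightarrow> nat \<Rightarrow> 'a mat) \<Rightarrow> nat list \<Rightarrow> 'a mat" where
  "out_trans Trans Out [a, b] = Out b a"
| "out_trans Trans Out (a # b # c # ps) = out_trans Trans Out (b # c # ps) * Trans b c a"
| "out_trans Trans Out _ = undefined"

definition path_prod ::
  "(nat \<Rightarrow> nat \<Rightarrow> 'a::field mat) \<Rightarrow> (nat \<Rightarrow> nat \<Rightarrow> nat \<Rightarrow> 'a mat) \<Rightarrow> (nat \<Rightarrow> nat \<Rightarrow> 'a mat)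
     \<Rightarrow> nat list \<Rightarrow> 'a mat" where
  "path_prod Inp Trans Out p = out_trans Trans Out p * Inp (p ! 0) (p ! 1)"

text \<open>
  \<open>m\<close> gives the output (row) dimensions, \<open>n\<close> the input (column) dimensions and
  \<open>\<rho>\<close> the rank-profile; only the values on vertices and on arcs of \<open>G\<close> matter. A
  \<^const>\<open>vpath\<close> is a walk without repeated vertices, given by its vertices; in a tree there is
  exactly one from \<open>j\<close> to \<open>i\<close>.
\<close>

definition is_TQS ::
  "nat pair_pre_digraph \<Rightarrow> (nat \<Rightarrow> nat) \<Rightarrow> (nat \<Rightarrow> nat) \<Rightarrow> (nat \<times> nat \<Rightarrow> nat) \<Rightarrow> 'a::field mat \<Rightarrow> bool"
where
  "is_TQS G m n \<rho> T \<longleftrightarrow>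
     T \<in> carrier_mat (\<Sum>i\<in>pverts G. m i) (\<Sum>i\<in>pverts G. n i) \<and>
     (\<exists>D Inp Trans Out.
        (\<forall>k\<in>pverts G. D k \<in> carrier_mat (m k) (n k)) \<and>
        (\<forall>(k, j)\<in>parcs G. Inp k j \<in> carrier_mat (\<rho> (k, j)) (n k)) \<and>
        (\<forall>k\<in>pverts G. \<forall>i\<in>neighbors G k. \<forall>j\<in>neighbors G k. i \<noteq> j \<longrightarrow>
           Trans k i j \<in> carrier_mat (\<rho> (k, i)) (\<rho> (j, k))) \<and>
        (\<forall>(i, k)\<in>parcs G. Out k i \<in> carrier_mat (m k) (\<rho> (i, k))) \<and>
        (\<forall>i\<in>pverts G. block m n T i i = D i) \<and>
        (\<forall>i\<in>pverts G. \<forall>j\<in>pverts G. i \<noteq> j \<longrightarrow>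
           (\<forall>p. vpath p (with_proj G) \<and> hd p = j \<and> last p = i \<longrightarrow>
              block m n T i j = path_prod Inp Trans Out p)))"

end

theory Submission
  imports Defs
begin

text \<open>
  The sum of two tree quasi-separable matrices is realised by running the two realisations side by
  side, as for the parallel connection of two linear systems. On every arc \<open>e\<close> the state space
  is the direct sum of the two given ones, of dimension \<open>\<rho>1 e + \<rho>2 e\<close>. The input matrices feed
  both summands and are stacked vertically, the transition matrices act on each summand separately
  and are block diagonal, and the output matrices add up the two contributions and are placed next
  to each other horizontally:
  \[ \mathrm{Out} = (O_1 \; O_2), \qquad \mathrm{Trans} = \mathrm{diag}(A_1, A_2), \qquad
     \mathrm{Inp} = (I_1^T \; I_2^T)^T. \]
  A horizontal pair times a block diagonal matrix is again a horizontal pair, so along any path the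
  product of the output matrix with the transition matrices is the horizontal pair of the two
  separate products (\<open>out_trans_parallel\<close>). Multiplication with the stacked input matrix then
  adds the two path products (\<open>path_prod_parallel\<close>). Forming blocks is additive as well, which
  gives the theorem.

  The sizes of the factors match because a path does not turn back on itself: the transition matrix
  from a neighbour \<open>a\<close> through \<open>b\<close> to a neighbour \<open>c\<close> has a prescribed size just
  for \<open>a \<noteq> c\<close>.
\<close>

section \<open>Horizontal pairs and block diagonal matrices\<close>

text \<open>
  The lower blocks have no rows: in this form the horizontal pair is a two by two block matrix, and
  its products follow from \<open>mult_four_block_mat\<close>.
\<close>

definition append_cols :: "'a::zero mat \<Rightarrow> 'a mat \<Rightarrow> 'a mat" where
  "append_cols A B = four_block_mat A B (0\<^sub>m 0 (dim_col A)) (0\<^sub>m 0 (dim_col B))"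

definition diag_pair :: "'a::zero mat \<Rightarrow> 'a mat \<Rightarrow> 'a mat" where
  "diag_pair A B =
     four_block_mat A (0\<^sub>m (dim_row A) (dim_col B)) (0\<^sub>m (dim_row B) (dim_col A)) B"

lemma append_cols_carrier:
  "A \<in> carrier_mat r c1 \<Longrightarrow> B \<in> carrier_mat r c2 \<Longrightarrow> append_cols A B \<in> carrier_mat r (c1 + c2)"
  unfolding append_cols_def by auto

lemma diag_pair_carrier:
  "A \<in> carrier_mat r1 c1 \<Longrightarrow> B \<in> carrier_mat r2 c2 \<Longrightarrow>
     diag_pair A B \<in> carrier_mat (r1 + r2) (c1 + c2)"
  unfolding diag_pair_def by auto

lemma append_cols_mult_diag_pair:
  fixes A B C D :: "'a::semiring_0 mat"
  assumes A: "A \<in> carrier_mat r k1" and B: "B \<in> carrier_mat r k2"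
    and C: "C \<in> carrier_mat k1 c1" and D: "D \<in> carrier_mat k2 c2"
  shows "append_cols A B * diag_pair C D = append_cols (A * C) (B * D)"
proof -
  have "append_cols A B * diag_pair C D
      = four_block_mat A B (0\<^sub>m 0 k1) (0\<^sub>m 0 k2) * four_block_mat C (0\<^sub>m k1 c2) (0\<^sub>m k2 c1) D"
    using assms unfolding append_cols_def diag_pair_def by auto
  also have "\<dots> = four_block_mat (A * C + B * 0\<^sub>m k2 c1) (A * 0\<^sub>m k1 c2 + B * D)
      (0\<^sub>m 0 k1 * C + 0\<^sub>m 0 k2 * 0\<^sub>m k2 c1) (0\<^sub>m 0 k1 * 0\<^sub>m k1 c2 + 0\<^sub>m 0 k2 * D)"
    by (rule mult_four_block_mat) (use assms in auto)
  also have "\<dots> = append_cols (A * C) (B * D)"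
    unfolding append_cols_def by (rule cong_four_block_mat) (use assms in auto)
  finally show ?thesis .
qed

lemma append_cols_mult_append_rows:
  fixes A B C D :: "'a::semiring_0 mat"
  assumes A: "A \<in> carrier_mat r k1" and B: "B \<in> carrier_mat r k2"
    and C: "C \<in> carrier_mat k1 c" and D: "D \<in> carrier_mat k2 c"
  shows "append_cols A B * (C @\<^sub>r D) = A * C + B * D"
proof -
  have "append_cols A B * (C @\<^sub>r D)
      = four_block_mat A B (0\<^sub>m 0 k1) (0\<^sub>m 0 k2) * four_block_mat C (0\<^sub>m k1 0) D (0\<^sub>m k2 0)"
    using assms unfolding append_cols_def append_rows_def by auto
  also have "\<dots> = four_block_mat (A * C + B * D) (A * 0\<^sub>m k1 0 + B * 0\<^sub>m k2 0)
      (0\<^sub>m 0 k1 * C + 0\<^sub>m 0 k2 * D) (0\<^sub>m 0 k1 * 0\<^sub>m k1 0 + 0\<^sub>m 0 k2 * 0\<^sub>m k2 0)"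
    by (rule mult_four_block_mat) (use assms in auto)
  also have "\<dots> = A * C + B * D"
    by (rule eq_matI) (use assms in auto)
  finally show ?thesis .
qed

section \<open>Additivity of blocks\<close>

text \<open>
  The entries of a block are read at shifted indices of the whole matrix; the addition of matrices
  is entrywise only within their dimensions, so the shifted indices have to stay in range.
\<close>

lemma offset_in_range:
  assumes "i \<in> {1..K}" "r < d i"
  shows "offset d i + r < (\<Sum>l\<in>{1..K}. d l)"
proof -
  have "offset d i + d i = (\<Sum>l\<in>{1..<Suc i}. d l)"
    using assms(1) by (simp add: offset_def)
  also have "\<dots> \<le> (\<Sum>l\<in>{1..K}. d l)"
    using assms(1) by (intro sum_mono2) auto
  finally show ?thesis using assms(2) by linarith
qed

lemma block_add:
  assumes "T1 \<in> carrier_mat (\<Sum>i\<in>{1..K}. m i) (\<Sum>i\<in>{1..K}. n i)"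
    and "T2 \<in> carrier_mat (\<Sum>i\<in>{1..K}. m i) (\<Sum>i\<in>{1..K}. n i)"
    and "i \<in> {1..K}" "j \<in> {1..K}"
  shows "block m n (T1 + T2) i j = block m n T1 i j + block m n T2 i j"
proof (rule eq_matI)
  fix r c
  assume "r < dim_row (block m n T1 i j + block m n T2 i j)"
    and "c < dim_col (block m n T1 i j + block m n T2 i j)"
  hence rc: "r < m i" "c < n j" by (simp_all add: block_def)
  have "offset m i + r < dim_row T2" "offset n j + c < dim_col T2"
    using offset_in_range[of i K r m] offset_in_range[of j K c n] rc assms by auto
  then show "block m n (T1 + T2) i j $$ (r, c) = (block m n T1 i j + block m n T2 i j) $$ (r, c)"
    using rc by (simp add: block_def)
qed (simp_all add: block_def)

section \<open>Parallel connection along a path\<close>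

definition generator_dims ::
  "nat pair_pre_digraph \<Rightarrow> (nat \<Rightarrow> nat) \<Rightarrow> (nat \<Rightarrow> nat) \<Rightarrow> (nat \<times> nat \<Rightarrow> nat) \<Rightarrow>
     (nat \<Rightarrow> nat \<Rightarrow> 'a mat) \<Rightarrow> (nat \<Rightarrow> nat \<Rightarrow> nat \<Rightarrow> 'a mat) \<Rightarrow> (nat \<Rightarrow> nat \<Rightarrow> 'a mat) \<Rightarrow> bool"
where
  "generator_dims G m n \<rho> Inp Trans Out \<longleftrightarrow>
     (\<forall>(k, j)\<in>parcs G. Inp k j \<in> carrier_mat (\<rho> (k, j)) (n k)) \<and>
     (\<forall>k\<in>pverts G. \<forall>i\<in>neighbors G k. \<forall>j\<in>neighbors G k. i \<noteq> j \<longrightarrow>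
        Trans k i j \<in> carrier_mat (\<rho> (k, i)) (\<rho> (j, k))) \<and>
     (\<forall>(i, k)\<in>parcs G. Out k i \<in> carrier_mat (m k) (\<rho> (i, k)))"

definition realizes_blocks ::
  "nat pair_pre_digraph \<Rightarrow> (nat \<Rightarrow> nat) \<Rightarrow> (nat \<Rightarrow> nat) \<Rightarrow> 'a::field mat \<Rightarrow>
     (nat \<Rightarrow> nat \<Rightarrow> 'a mat) \<Rightarrow> (nat \<Rightarrow> nat \<Rightarrow> nat \<Rightarrow> 'a mat) \<Rightarrow> (nat \<Rightarrow> nat \<Rightarrow> 'a mat) \<Rightarrow> bool"
where
  "realizes_blocks G m n T Inp Trans Out \<longleftrightarrow>
     (\<forall>i\<in>pverts G. \<forall>j\<in>pverts G. i \<noteq> j \<longrightarrow>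
        (\<forall>p. vpath p (with_proj G) \<and> hd p = j \<and> last p = i \<longrightarrow>
           block m n T i j = path_prod Inp Trans Out p))"

text \<open>
  The diagonal blocks put no constraint on the matrix, since they serve as the matrices \<open>D\<close>
  themselves. What has to be found are the input, transition and output matrices.
\<close>

lemma is_TQS_iff_generators:
  "is_TQS G m n \<rho> T \<longleftrightarrow>
     T \<in> carrier_mat (\<Sum>i\<in>pverts G. m i) (\<Sum>i\<in>pverts G. n i) \<and>
     (\<exists>Inp Trans Out. generator_dims G m n \<rho> Inp Trans Out \<and>
        realizes_blocks G m n T Inp Trans Out)"
proof -
  have "\<exists>D. (\<forall>k\<in>pverts G. D k \<in> carrier_mat (m k) (n k)) \<and> (\<forall>i\<in>pverts G. block m n T i i = D i)"
    by (rule exI[of _ "\<lambda>k. block m n T k k"]) (simp add: block_def)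
  moreover have "is_TQS G m n \<rho> T \<longleftrightarrow>
     T \<in> carrier_mat (\<Sum>i\<in>pverts G. m i) (\<Sum>i\<in>pverts G. n i) \<and>
     (\<exists>D Inp Trans Out.
        ((\<forall>k\<in>pverts G. D k \<in> carrier_mat (m k) (n k)) \<and> (\<forall>i\<in>pverts G. block m n T i i = D i)) \<and>
        generator_dims G m n \<rho> Inp Trans Out \<and> realizes_blocks G m n T Inp Trans Out)"
    unfolding is_TQS_def generator_dims_def realizes_blocks_def
    by (simp only: conj_assoc conj_left_commute)
  ultimately show ?thesis by metis
qed

lemma generator_dimsD:
  assumes "generator_dims G m n \<rho> Inp Trans Out"
  shows "(k, j) \<in> parcs G \<Longrightarrow> Inp k j \<in> carrier_mat (\<rho> (k, j)) (n k)"
    and "k \<in> pverts G \<Longrightarrow> i \<in> neighbors G k \<Longrightarrow> j \<in> neighbors G k \<Longrightarrow> i \<noteq> j \<Longrightarrow>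
      Trans k i j \<in> carrier_mat (\<rho> (k, i)) (\<rho> (j, k))"
    and "(i, k) \<in> parcs G \<Longrightarrow> Out k i \<in> carrier_mat (m k) (\<rho> (i, k))"
  using assms unfolding generator_dims_def by (simp_all add: Ball_def)

lemma generator_dims_parallel:
  assumes g1: "generator_dims G m n \<rho>1 Inp1 Trans1 Out1"
    and g2: "generator_dims G m n \<rho>2 Inp2 Trans2 Out2"
  shows "generator_dims G m n (\<lambda>e. \<rho>1 e + \<rho>2 e)
    (\<lambda>k j. Inp1 k j @\<^sub>r Inp2 k j)
    (\<lambda>k i j. diag_pair (Trans1 k i j) (Trans2 k i j))
    (\<lambda>k i. append_cols (Out1 k i) (Out2 k i))"
  unfolding generator_dims_def
proof (intro conjI ballI impI, goal_cases)
  case (1 e)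
  then show ?case
    by (cases e) (simp add: carrier_append_rows generator_dimsD(1)[OF g1] generator_dimsD(1)[OF g2])
next
  case (2 k i j)
  then show ?case
    by (intro diag_pair_carrier generator_dimsD(2)[OF g1] generator_dimsD(2)[OF g2])
next
  case (3 e)
  then show ?case
    by (cases e) (simp add: append_cols_carrier generator_dimsD(3)[OF g1] generator_dimsD(3)[OF g2])
qed

context
  fixes G :: "nat pair_pre_digraph"
  assumes pair_graph: "pair_graph G"
begin

interpretation pair_graph G by (fact pair_graph)

lemma Trans_carrier_on_path:
  assumes "generator_dims G m n \<rho> Inp Trans Out"
    and "(a, b) \<in> parcs G" "(b, c) \<in> parcs G" "a \<noteq> c"
  shows "Trans b c a \<in> carrier_mat (\<rho> (b, c)) (\<rho> (a, b))"
proof -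
  have "a \<in> neighbors G b" "c \<in> neighbors G b" "b \<in> pverts G"
    using arcs_symmetric[OF assms(2)] assms(3) in_arcsD1[OF assms(3)]
    by (simp_all add: neighbors_def)
  then show ?thesis using generator_dimsD(2)[OF assms(1)] assms(4) by simp
qed

lemma out_trans_carrier:
  assumes "generator_dims G m n \<rho> Inp Trans Out"
    and "set (vwalk_arcs (a # b # ps)) \<subseteq> parcs G" "distinct (a # b # ps)"
  shows "out_trans Trans Out (a # b # ps) \<in> carrier_mat (m (last (b # ps))) (\<rho> (a, b))"
  using assms(2,3)
proof (induction ps arbitrary: a b)
  case Nil
  then show ?case using generator_dimsD(3)[OF assms(1)] by simp
next
  case (Cons c ps)
  have "out_trans Trans Out (b # c # ps) \<in> carrier_mat (m (last (c # ps))) (\<rho> (b, c))"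
    using Cons.prems by (intro Cons.IH) auto
  moreover have "Trans b c a \<in> carrier_mat (\<rho> (b, c)) (\<rho> (a, b))"
    using Cons.prems by (intro Trans_carrier_on_path[OF assms(1)]) auto
  ultimately show ?case by simp
qed

text \<open>
  Starting from the last vertex, each further step of the path multiplies a horizontal pair by a
  block diagonal matrix, which keeps the two summands apart.
\<close>

lemma out_trans_parallel:
  assumes g1: "generator_dims G m n \<rho>1 Inp1 Trans1 Out1"
    and g2: "generator_dims G m n \<rho>2 Inp2 Trans2 Out2"
    and "set (vwalk_arcs (a # b # ps)) \<subseteq> parcs G" "distinct (a # b # ps)"
  shows "out_trans (\<lambda>k i j. diag_pair (Trans1 k i j) (Trans2 k i j))
      (\<lambda>k i. append_cols (Out1 k i) (Out2 k i)) (a # b # ps)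
    = append_cols (out_trans Trans1 Out1 (a # b # ps)) (out_trans Trans2 Out2 (a # b # ps))"
  using assms(3,4)
proof (induction ps arbitrary: a b)
  case Nil
  then show ?case by simp
next
  case (Cons c ps)
  let ?T = "\<lambda>k i j. diag_pair (Trans1 k i j) (Trans2 k i j)"
  let ?O = "\<lambda>k i. append_cols (Out1 k i) (Out2 k i)"
  have arcs: "(a, b) \<in> parcs G" "(b, c) \<in> parcs G" "a \<noteq> c"
    and tail: "set (vwalk_arcs (b # c # ps)) \<subseteq> parcs G" "distinct (b # c # ps)"
    using Cons.prems by auto
  have "out_trans ?T ?O (a # b # c # ps)
      = append_cols (out_trans Trans1 Out1 (b # c # ps)) (out_trans Trans2 Out2 (b # c # ps))
        * diag_pair (Trans1 b c a) (Trans2 b c a)"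
    by (simp add: Cons.IH[OF tail])
  also have "\<dots> = append_cols (out_trans Trans1 Out1 (b # c # ps) * Trans1 b c a)
      (out_trans Trans2 Out2 (b # c # ps) * Trans2 b c a)"
    by (rule append_cols_mult_diag_pair[OF out_trans_carrier[OF g1 tail]
        out_trans_carrier[OF g2 tail] Trans_carrier_on_path[OF g1 arcs]
        Trans_carrier_on_path[OF g2 arcs]])
  finally show ?case by simp
qed

lemma path_prod_parallel:
  assumes g1: "generator_dims G m n \<rho>1 Inp1 Trans1 Out1"
    and g2: "generator_dims G m n \<rho>2 Inp2 Trans2 Out2"
    and p: "vpath p (with_proj G)" "hd p \<noteq> last p"
  shows "path_prod (\<lambda>k j. Inp1 k j @\<^sub>r Inp2 k j)
      (\<lambda>k i j. diag_pair (Trans1 k i j) (Trans2 k i j))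
      (\<lambda>k i. append_cols (Out1 k i) (Out2 k i)) p
    = path_prod Inp1 Trans1 Out1 p + path_prod Inp2 Trans2 Out2 p"
proof -
  have "p \<noteq> []" using p(1) by (simp add: vpath_def vwalk_def)
  then obtain a b ps where p_eq: "p = a # b # ps"
    using p(2) by (cases p rule: vwalk_arcs.cases) simp_all
  have path: "set (vwalk_arcs (a # b # ps)) \<subseteq> parcs G" "distinct (a # b # ps)"
    using p(1) unfolding p_eq vpath_def vwalk_def by (auto simp: arcs_ends_conv)
  have inp: "Inp1 a b \<in> carrier_mat (\<rho>1 (a, b)) (n a)" "Inp2 a b \<in> carrier_mat (\<rho>2 (a, b)) (n a)"
    using path(1) generator_dimsD(1)[OF g1] generator_dimsD(1)[OF g2] by simp_all
  show ?thesis
    unfolding path_prod_def p_eq out_trans_parallel[OF g1 g2 path]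
    using append_cols_mult_append_rows[OF out_trans_carrier[OF g1 path]
        out_trans_carrier[OF g2 path] inp]
    by simp
qed

end

section \<open>Sums of tree quasi-separable matrices\<close>

theorem proposition4p6:
  fixes G :: "nat pair_pre_digraph" and K :: nat
    and m n :: "nat \<Rightarrow> nat"
    and \<rho>1 \<rho>2 :: "nat \<times> nat \<Rightarrow> nat"
    and T1 T2 :: "'a::field mat"
  assumes "tree_graph G K"
    and "T1 \<in> carrier_mat (\<Sum>i\<in>{1..K}. m i) (\<Sum>i\<in>{1..K}. n i)"
    and "T2 \<in> carrier_mat (\<Sum>i\<in>{1..K}. m i) (\<Sum>i\<in>{1..K}. n i)"
    and "is_TQS G m n \<rho>1 T1"
    and "is_TQS G m n \<rho>2 T2"
  shows "is_TQS G m n (\<lambda>e. \<rho>1 e + \<rho>2 e) (T1 + T2)"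
proof -
  interpret tree_graph G K by fact
  obtain Inp1 Trans1 Out1 where g1: "generator_dims G m n \<rho>1 Inp1 Trans1 Out1"
    and T1: "realizes_blocks G m n T1 Inp1 Trans1 Out1"
    using assms(4) unfolding is_TQS_iff_generators by blast
  obtain Inp2 Trans2 Out2 where g2: "generator_dims G m n \<rho>2 Inp2 Trans2 Out2"
    and T2: "realizes_blocks G m n T2 Inp2 Trans2 Out2"
    using assms(5) unfolding is_TQS_iff_generators by blast
  let ?Inp = "\<lambda>k j. Inp1 k j @\<^sub>r Inp2 k j"
  let ?Trans = "\<lambda>k i j. diag_pair (Trans1 k i j) (Trans2 k i j)"
  let ?Out = "\<lambda>k i. append_cols (Out1 k i) (Out2 k i)"
  have "block m n (T1 + T2) i j = path_prod ?Inp ?Trans ?Out p"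
    if ij: "i \<in> pverts G" "j \<in> pverts G" "i \<noteq> j"
      and p: "vpath p (with_proj G)" "hd p = j" "last p = i" for i j p
  proof -
    have "block m n (T1 + T2) i j = block m n T1 i j + block m n T2 i j"
      using block_add[OF assms(2,3)] ij verts_eq by simp
    also have "\<dots> = path_prod Inp1 Trans1 Out1 p + path_prod Inp2 Trans2 Out2 p"
      using T1 T2 ij p unfolding realizes_blocks_def by simp
    also have "\<dots> = path_prod ?Inp ?Trans ?Out p"
      using path_prod_parallel[OF pair_graph_axioms g1 g2 p(1)] ij(3) p(2,3) by simp
    finally show ?thesis .
  qed
  then have "realizes_blocks G m n (T1 + T2) ?Inp ?Trans ?Out"
    unfolding realizes_blocks_def by simp
  moreover have "T1 + T2 \<in> carrier_mat (\<Sum>i\<in>pverts G. m i) (\<Sum>i\<in>pverts G. n i)"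
    using assms(2,3) by (simp add: verts_eq)
  ultimately show ?thesis
    using generator_dims_parallel[OF g1 g2] unfolding is_TQS_iff_generators by blast
qed

end
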